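(* Let $U\in M_n(\mathbb{C})$ be a biunitary matrix and let $D\subset M_n(\mathbb{C})$ be the algebra of diagonal matrices. If $\dim([D,U^*DU])=n^2-2n+1$, then $U$ is isolated among all biunitaries (up to equivalence): there exists $\varepsilon>0$ such that every biunitary $V\in M_n(\mathbb{C})$ with $\|V-U\|<\varepsilon$ is equivalent to $U$.
   Context: A biunitary (complex Hadamard) matrix of order $n$ is a unitary $U\in M_n(\mathbb{C})$ all of whose entries have absolute value $1/\sqrt n$. Equivalently, with $\tau=\frac1n\mathrm{Tr}$, the square $$\mathfrak{C}_U=\left(\begin{matrix} D & \subset & M_n(\mathbb{C})\\ \cup & & \cup\\ \mathbb{C} & \subset & U^*DU\end{matrix},\tau\right)$$ is a commuting square, i.e. $E_DE_{U^*DU}=E_{\mathbb{C}}$ for the $\tau$-preserving conditional expectations. Two biunitaries $U,V$ of order $n$ are equivalent if the commuting squares $\mathfrak{C}_U$ and $\mathfrak{C}_V$ are isomorphic, i.e. there is a ($\tau$-preserving) $*$-automorphism $\phi$ of $M_n(\mathbb{C})$ with $\phi(D)=D$ and $\phi(U^*DU)=V^*DV$. For vector subspaces $V,W$ of $M_n(\mathbb{C})$, $[V,W]=\mathrm{span}\{vw-wv: v\in V,w\in W\}$. *)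

theory Defs
  imports "HOL-Analysis.Analysis"
begin

text \<open>The library constants \<^const>\<open>span\<close> and \<^const>\<open>dim\<close> on \<open>complex ^ 'n ^ 'n\<close> refer to the
  structure of a \<^emph>\<open>real\<close> vector space. The complex structure is introduced here; complex span and
  complex dimension are \<open>cmat.span\<close> and \<open>cmat.dim\<close>.\<close>

definition cscale :: "complex \<Rightarrow> complex ^ 'n ^ 'm \<Rightarrow> complex ^ 'n ^ 'm" where
  "cscale c A = (\<chi> i j. c * A $ i $ j)"

global_interpretation cmat: vector_space "cscale :: complex \<Rightarrow> complex ^ 'n ^ 'm \<Rightarrow> complex ^ 'n ^ 'm"
  by standard (simp_all add: cscale_def vec_eq_iff algebra_simps)

definition adjoint_mat :: "complex ^ 'n ^ 'm \<Rightarrow> complex ^ 'm ^ 'n" where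
  "adjoint_mat A = (\<chi> i j. cnj (A $ j $ i))"

definition unitary_mat :: "complex ^ 'n ^ 'n \<Rightarrow> bool" where
  "unitary_mat U \<longleftrightarrow> adjoint_mat U ** U = mat 1 \<and> U ** adjoint_mat U = mat 1"

definition biunitary :: "complex ^ 'n ^ 'n \<Rightarrow> bool" where
  "biunitary U \<longleftrightarrow> unitary_mat U \<and> (\<forall>i j. cmod (U $ i $ j) = 1 / sqrt (real CARD('n)))"

definition diag_alg :: "(complex ^ 'n ^ 'n) set" where
  "diag_alg = {A. \<forall>i j. i \<noteq> j \<longrightarrow> A $ i $ j = 0}"

definition conj_diag_alg :: "complex ^ 'n ^ 'n \<Rightarrow> (complex ^ 'n ^ 'n) set" where
  "conj_diag_alg U = (\<lambda>A. adjoint_mat U ** A ** U) ` diag_alg"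

definition commutator_space ::
    "(complex ^ 'n ^ 'n) set \<Rightarrow> (complex ^ 'n ^ 'n) set \<Rightarrow> (complex ^ 'n ^ 'n) set" where
  "commutator_space V W = cmat.span {v ** w - w ** v | v w. v \<in> V \<and> w \<in> W}"

definition normalized_trace :: "complex ^ 'n ^ 'n \<Rightarrow> complex" where
  "normalized_trace A = trace A / of_nat CARD('n)"

definition star_automorphism :: "(complex ^ 'n ^ 'n \<Rightarrow> complex ^ 'n ^ 'n) \<Rightarrow> bool" where
  "star_automorphism \<phi> \<longleftrightarrow>
     bij \<phi> \<and>
     Vector_Spaces.linear cscale cscale \<phi> \<and>
     (\<forall>A B. \<phi> (A ** B) = \<phi> A ** \<phi> B) \<and>
     (\<forall>A. \<phi> (adjoint_mat A) = adjoint_mat (\<phi> A))"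

text \<open>Isomorphism of the commuting squares associated with \<open>U\<close> and \<open>V\<close>. The corner \<open>\<complex>\<close> is preserved
  by every automorphism.\<close>

definition biunitary_equiv :: "complex ^ 'n ^ 'n \<Rightarrow> complex ^ 'n ^ 'n \<Rightarrow> bool" where
  "biunitary_equiv U V \<longleftrightarrow>
     (\<exists>\<phi>. star_automorphism \<phi> \<and>
          (\<forall>A. normalized_trace (\<phi> A) = normalized_trace A) \<and>
          \<phi> ` diag_alg = diag_alg \<and>
          \<phi> ` conj_diag_alg U = conj_diag_alg V)"

definition op_norm :: "complex ^ 'n ^ 'm \<Rightarrow> real" where
  "op_norm A = onorm (\<lambda>x. A *v x)"

end

theory Submission
  imports Defs
begin

text \<open>
  Multiplying rows and columns of \<open>V\<close> by phases does not change its class, so one may assume that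
  \<open>V\<close> agrees with \<open>U\<close> in one row and one column. Write \<open>V\<^sub>i\<^sub>j = U\<^sub>i\<^sub>j (1 + z\<^sub>i\<^sub>j)\<close>. As
  \<open>|1 + z\<^sub>i\<^sub>j| = 1\<close>, one has \<open>cnj z\<^sub>i\<^sub>j = - z\<^sub>i\<^sub>j - |z\<^sub>i\<^sub>j|\<^sup>2\<close>, so unitarity of \<open>V\<close> becomes \<open>L z = O(|z|\<^sup>2)\<close> with the
  complex linear map \<open>L z = (\<Sum>i k. z\<^sub>i\<^sub>k [e\<^sub>k, U\<^sup>* e\<^sub>i U])\<close>. The commutators \<open>[e\<^sub>k, U\<^sup>* e\<^sub>i U]\<close> span
  \<open>[D, U\<^sup>*DU]\<close>, and since their sums over \<open>i\<close> and over \<open>k\<close> vanish, those avoiding one row and one column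
  already do. There are \<open>(n-1)\<^sup>2\<close> of these, so by the dimension hypothesis they are linearly
  independent, i.e. \<open>L\<close> is injective, hence bounded below, on normalized \<open>z\<close>. Therefore \<open>z = 0\<close> when \<open>z\<close> is
  small.
\<close>

section \<open>Entries of matrices and norm comparisons\<close>

lemma cscale_nth [simp]: "cscale c A $ i $ j = c * A $ i $ j"
  by (simp add: cscale_def)

lemma adjoint_mat_nth [simp]: "adjoint_mat A $ i $ j = cnj (A $ j $ i)"
  by (simp add: adjoint_mat_def)

lemma mult_cnj_eq_1: "cmod x = 1 \<Longrightarrow> x * cnj x = 1"
  by (simp flip: complex_norm_square)

lemma conj_diag_nth:
  fixes U A :: "complex ^ 'n ^ 'n"
  assumes "A \<in> diag_alg"
  shows "(adjoint_mat U ** A ** U) $ p $ q = (\<Sum>i\<in>UNIV. cnj (U $ i $ p) * A $ i $ i * U $ i $ q)"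
proof -
  have "(\<Sum>k\<in>UNIV. cnj (U $ k $ p) * A $ k $ i) = cnj (U $ i $ p) * A $ i $ i" for i
    using assms by (subst sum.remove[of _ i]) (auto simp: diag_alg_def intro!: sum.neutral)
  then show ?thesis
    by (simp add: matrix_matrix_mult_def)
qed

lemma diag_mult_nth:
  fixes A B :: "complex ^ 'n ^ 'n"
  assumes "A \<in> diag_alg"
  shows "(A ** B) $ p $ q = A $ p $ p * B $ p $ q"
    and "(B ** A) $ p $ q = B $ p $ q * A $ q $ q"
proof -
  show "(A ** B) $ p $ q = A $ p $ p * B $ p $ q"
    unfolding matrix_matrix_mult_def
    using assms by (simp, subst sum.remove[of _ p]) (auto simp: diag_alg_def intro!: sum.neutral)
  show "(B ** A) $ p $ q = B $ p $ q * A $ q $ q"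
    unfolding matrix_matrix_mult_def
    using assms by (simp, subst sum.remove[of _ q]) (auto simp: diag_alg_def intro!: sum.neutral)
qed

lemma unitary_mat_columns:
  assumes "unitary_mat U"
  shows "(\<Sum>i\<in>UNIV. cnj (U $ i $ p) * U $ i $ q) = (if p = q then 1 else 0)"
proof -
  have "(adjoint_mat U ** U) $ p $ q = mat 1 $ p $ q"
    using assms by (simp add: unitary_mat_def)
  then show ?thesis
    by (simp add: matrix_matrix_mult_def mat_def)
qed

lemma cmod_nth_le_norm: "cmod (A $ i $ j) \<le> norm (A :: complex ^ 'n ^ 'm)"
  by (meson Finite_Cartesian_Product.norm_nth_le order_trans)

lemma norm_le_sum_cmod: "norm (A :: complex ^ 'n ^ 'm) \<le> (\<Sum>i\<in>UNIV. \<Sum>j\<in>UNIV. cmod (A $ i $ j))"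
proof -
  have "norm A \<le> (\<Sum>i\<in>UNIV. norm (A $ i))"
    unfolding norm_vec_def[of A] by (rule L2_set_le_sum) simp
  also have "\<dots> \<le> (\<Sum>i\<in>UNIV. \<Sum>j\<in>UNIV. cmod (A $ i $ j))"
    unfolding norm_vec_def[of "A $ _"] by (intro sum_mono L2_set_le_sum) simp
  finally show ?thesis .
qed

lemma cmod_nth_le_op_norm: "cmod (A $ i $ j) \<le> op_norm (A :: complex ^ 'n ^ 'm)"
proof -
  have "cmod (A $ i $ j) = cmod ((A *v axis j 1) $ i)"
    by (simp add: matrix_vector_mult_def axis_def if_distrib cong: if_cong)
  also have "\<dots> \<le> norm (A *v axis j 1)"
    by (rule Finite_Cartesian_Product.norm_nth_le)
  also have "\<dots> \<le> onorm (\<lambda>x. A *v x) * norm (axis j (1::complex))"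
    by (rule onorm) (rule matrix_vector_mul_bounded_linear)
  finally show ?thesis
    by (simp add: op_norm_def norm_axis_1)
qed

section \<open>Commutators of the minimal projections of the two algebras\<close>

text \<open>Entrywise form of \<open>[e_k, U^* e_i U]\<close>, where \<open>e_k\<close> is the
  diagonal projection onto coordinate \<open>k\<close>.\<close>

definition unit_comm :: "complex ^ 'n ^ 'n \<Rightarrow> 'n \<Rightarrow> 'n \<Rightarrow> complex ^ 'n ^ 'n" where
  "unit_comm U i k =
     (\<chi> p q. ((if p = k then 1 else 0) - (if q = k then 1 else 0)) * (cnj (U $ i $ p) * U $ i $ q))"

text \<open>The projections \<open>e_k\<close> sum to the identity, which commutes with
  everything.\<close>

lemma unit_comm_row_sum: "(\<Sum>k\<in>UNIV. unit_comm U i k) = 0"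
  by (simp add: vec_eq_iff unit_comm_def flip: sum_distrib_right) (simp add: sum_subtractf)

text \<open>The projections \<open>U^* e_i U\<close> sum to \<open>U^* U = 1\<close>.\<close>

lemma unit_comm_col_sum:
  assumes "unitary_mat U"
  shows "(\<Sum>i\<in>UNIV. unit_comm U i k) = 0"
  using unitary_mat_columns[OF assms]
  by (simp add: vec_eq_iff unit_comm_def flip: sum_distrib_left)

text \<open>Bilinearity of the commutator, with both arguments expanded in minimal projections. This
  inclusion is enough to bound the dimension from above.\<close>

lemma commutator_space_subset_span_unit_comm:
  "commutator_space diag_alg (conj_diag_alg U) \<subseteq> cmat.span (range (case_prod (unit_comm U)))"
  unfolding commutator_space_def
proof (rule cmat.span_minimal[OF _ cmat.subspace_span], clarify)
  fix v w assume v: "v \<in> (diag_alg :: (complex ^ 'a ^ 'a) set)" and "w \<in> conj_diag_alg U"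
  then obtain A where A: "A \<in> diag_alg" and w: "w = adjoint_mat U ** A ** U"
    by (auto simp: conj_diag_alg_def)
  have "(v ** w - w ** v) $ p $ q =
      (\<Sum>i\<in>UNIV. \<Sum>k\<in>UNIV. cscale (v $ k $ k * A $ i $ i) (unit_comm U i k)) $ p $ q" for p q
  proof -
    have "(\<Sum>k\<in>UNIV. v $ k $ k * A $ i $ i *
        (((if p = k then 1 else 0) - (if q = k then 1 else 0)) * (cnj (U $ i $ p) * U $ i $ q)))
      = (v $ p $ p - v $ q $ q) * (cnj (U $ i $ p) * A $ i $ i * U $ i $ q)" for i
    proof -
      have "(\<Sum>k\<in>UNIV. v $ k $ k * A $ i $ i *
        (((if p = k then 1 else 0) - (if q = k then 1 else 0)) * (cnj (U $ i $ p) * U $ i $ q)))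
        = (\<Sum>k\<in>UNIV. (if p = k then v $ k $ k else 0) - (if q = k then v $ k $ k else 0)) *
           (cnj (U $ i $ p) * A $ i $ i * U $ i $ q)"
        unfolding sum_distrib_right by (rule sum.cong) auto
      then show ?thesis by (simp add: sum_subtractf)
    qed
    then have "(\<Sum>i\<in>UNIV. \<Sum>k\<in>UNIV. cscale (v $ k $ k * A $ i $ i) (unit_comm U i k)) $ p $ q =
        (v $ p $ p - v $ q $ q) * w $ p $ q"
      by (simp add: unit_comm_def w conj_diag_nth[OF A] sum_distrib_left)
    then show ?thesis
      using v by (simp add: diag_mult_nth algebra_simps)
  qed
  then have "v ** w - w ** v = (\<Sum>i\<in>UNIV. \<Sum>k\<in>UNIV. cscale (v $ k $ k * A $ i $ i) (unit_comm U i k))"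
    by (simp add: vec_eq_iff)
  moreover have "unit_comm U i k \<in> cmat.span (range (case_prod (unit_comm U)))" for i k
    by (rule cmat.span_base) (auto intro: image_eqI[of _ _ "(i, k)"])
  ultimately show "v ** w - w ** v \<in> cmat.span (range (case_prod (unit_comm U)))"
    by (simp add: cmat.span_sum cmat.span_scale)
qed

lemma range_unit_comm_subset_span:
  assumes "unitary_mat U"
    and reduced: "\<And>i k. i \<noteq> o1 \<Longrightarrow> k \<noteq> o1 \<Longrightarrow> unit_comm U i k \<in> cmat.span T"
  shows "range (case_prod (unit_comm U)) \<subseteq> cmat.span T"
proof -
  have row: "unit_comm U i k \<in> cmat.span T" if "i \<noteq> o1" for i k
  proof (cases "k = o1")
    case True
    have "unit_comm U i o1 = - (\<Sum>k\<in>UNIV - {o1}. unit_comm U i k)"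
      using unit_comm_row_sum[of U i] by (simp add: sum.remove[of UNIV o1] eq_neg_iff_add_eq_0)
    then show ?thesis
      using True that reduced by (auto intro!: cmat.span_neg cmat.span_sum)
  qed (use that reduced in auto)
  have "unit_comm U i k \<in> cmat.span T" for i k
  proof (cases "i = o1")
    case True
    have "unit_comm U o1 k = - (\<Sum>i\<in>UNIV - {o1}. unit_comm U i k)"
      using unit_comm_col_sum[OF assms(1), of k]
      by (simp add: sum.remove[of UNIV o1] eq_neg_iff_add_eq_0)
    then show ?thesis
      using True row by (auto intro!: cmat.span_neg cmat.span_sum)
  qed (use row in auto)
  then show ?thesis by auto
qed

section \<open>Linearized unitarity\<close>

text \<open>Minus the first-order part of \<open>V^* V\<close> for
  \<open>V_ij = U_ij (1 + z_ij)\<close>, with \<open>cnj z\<close> replaced by \<open>-z\<close>;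
  the replacement makes the map complex linear.\<close>

definition defect_map :: "complex ^ 'n ^ 'n \<Rightarrow> complex ^ 'n ^ 'n \<Rightarrow> complex ^ 'n ^ 'n" where
  "defect_map U z = (\<chi> p q. \<Sum>i\<in>UNIV. (z $ i $ p - z $ i $ q) * (cnj (U $ i $ p) * U $ i $ q))"

lemma linear_defect_map: "linear (defect_map U)"
  by (rule linearI)
    (simp_all add: defect_map_def vec_eq_iff scaleR_sum_right algebra_simps
      flip: sum.distrib sum_subtractf)

lemma defect_map_eq_sum_unit_comm:
  "defect_map U z = (\<Sum>i\<in>UNIV. \<Sum>k\<in>UNIV. cscale (z $ i $ k) (unit_comm U i k))"
proof -
  have "(\<Sum>k\<in>UNIV. z $ i $ k *
      (((if p = k then 1 else 0) - (if q = k then 1 else 0)) * (cnj (U $ i $ p) * U $ i $ q)))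
    = (z $ i $ p - z $ i $ q) * (cnj (U $ i $ p) * U $ i $ q)" for i p q
  proof -
    have "(\<Sum>k\<in>UNIV. z $ i $ k *
      (((if p = k then 1 else 0) - (if q = k then 1 else 0)) * (cnj (U $ i $ p) * U $ i $ q)))
      = (\<Sum>k\<in>UNIV. (if p = k then z $ i $ k else 0) - (if q = k then z $ i $ k else 0)) *
         (cnj (U $ i $ p) * U $ i $ q)"
      unfolding sum_distrib_right by (rule sum.cong) auto
    then show ?thesis by (simp add: sum_subtractf)
  qed
  then show ?thesis
    by (simp add: vec_eq_iff defect_map_def unit_comm_def)
qed

definition normalized_at :: "'n \<Rightarrow> (complex ^ 'n ^ 'n) set" where
  "normalized_at o1 = {z. \<forall>i. z $ o1 $ i = 0 \<and> z $ i $ o1 = 0}"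

lemma subspace_normalized_at: "subspace (normalized_at o1)"
  by (simp add: subspace_def normalized_at_def)

text \<open>A nonzero \<open>z\<close> in the kernel would be a nontrivial relation among the
  \<open>(n-1)^2\<close> commutators off row and column \<open>o1\<close>. One of them could be
  dropped, and the remaining ones would be too few for the assumed dimension.\<close>

lemma defect_map_injective:
  fixes U :: "complex ^ 'n ^ 'n"
  assumes U: "unitary_mat U"
    and dim: "int (cmat.dim (commutator_space diag_alg (conj_diag_alg U)))
           = (int CARD('n))\<^sup>2 - 2 * int CARD('n) + 1"
    and z: "z \<in> normalized_at o1" and L: "defect_map U z = 0"
  shows "z = 0"
proof (rule ccontr)
  assume "z \<noteq> 0"
  then obtain i0 k0 where nz: "z $ i0 $ k0 \<noteq> 0"
    by (auto simp: vec_eq_iff)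
  then have ne: "i0 \<noteq> o1" "k0 \<noteq> o1"
    using z by (auto simp: normalized_at_def)
  define S where "S = (UNIV - {o1}) \<times> (UNIV - {o1}) - {(i0, k0)}"
  define T where "T = case_prod (unit_comm U) ` S"
  have base: "unit_comm U i k \<in> cmat.span T" if "i \<noteq> o1" "k \<noteq> o1" "(i, k) \<noteq> (i0, k0)" for i k
    unfolding T_def S_def using that by (intro cmat.span_base image_eqI[of _ _ "(i, k)"]) auto
  let ?f = "\<lambda>(i, k). cscale (z $ i $ k) (unit_comm U i k)"
  have "0 = (\<Sum>x\<in>UNIV. ?f x)"
    using L unfolding defect_map_eq_sum_unit_comm by (simp add: sum.cartesian_product)
  also have "\<dots> = cscale (z $ i0 $ k0) (unit_comm U i0 k0) + (\<Sum>x\<in>UNIV - {(i0, k0)}. ?f x)"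
    by (subst sum.remove[of _ "(i0, k0)"]) auto
  finally have "cscale (z $ i0 $ k0) (unit_comm U i0 k0) = - (\<Sum>x\<in>UNIV - {(i0, k0)}. ?f x)"
    by (simp add: eq_neg_iff_add_eq_0)
  also have "\<dots> \<in> cmat.span T"
  proof (intro cmat.span_neg cmat.span_sum)
    fix x assume "x \<in> UNIV - {(i0, k0)}"
    moreover obtain i k where x: "x = (i, k)" by fastforce
    ultimately have "(i, k) \<noteq> (i0, k0)" by simp
    show "?f x \<in> cmat.span T"
    proof (cases "i = o1 \<or> k = o1")
      case True
      then have "z $ i $ k = 0"
        using z by (auto simp: normalized_at_def)
      then show ?thesis by (simp add: x cmat.span_zero)
    next
      case False
      then show ?thesis
        using base \<open>(i, k) \<noteq> (i0, k0)\<close> by (simp add: x cmat.span_scale)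
    qed
  qed
  \<comment> \<open>Dividing the relation by its nonzero coefficient expresses the dropped
    commutator through the others.\<close>
  finally have "cscale (inverse (z $ i0 $ k0)) (cscale (z $ i0 $ k0) (unit_comm U i0 k0)) \<in> cmat.span T"
    by (rule cmat.span_scale)
  then have "unit_comm U i0 k0 \<in> cmat.span T"
    using nz by simp
  with base have "range (case_prod (unit_comm U)) \<subseteq> cmat.span T"
    by (intro range_unit_comm_subset_span[OF U, of o1]) blast
  then have "cmat.span (range (case_prod (unit_comm U))) \<subseteq> cmat.span T"
    by (rule cmat.span_minimal) (rule cmat.subspace_span)
  then have "cmat.dim (commutator_space diag_alg (conj_diag_alg U)) \<le> card T"
    using commutator_space_subset_span_unit_comm[of U]
    by (intro cmat.dim_le_card) (auto simp: T_def S_def)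
  also have "card T \<le> card S"
    unfolding T_def by (rule card_image_le) (simp add: S_def)
  also have "card S < card ((UNIV - {o1}) \<times> (UNIV - {o1}) :: ('n \<times> 'n) set)"
    unfolding S_def by (rule psubset_card_mono) (use ne in auto)
  also have "\<dots> = (CARD('n) - 1) * (CARD('n) - 1)"
    by (simp add: card_cartesian_product card_Diff_singleton)
  finally have "int (cmat.dim (commutator_space diag_alg (conj_diag_alg U)))
      < int ((CARD('n) - 1) * (CARD('n) - 1))"
    by (simp only: of_nat_less_iff)
  also have "\<dots> = (int CARD('n) - 1) * (int CARD('n) - 1)"
    by (simp add: of_nat_diff)
  finally show False
    using dim by (simp add: power2_eq_square algebra_simps)
qed

text \<open>Each entry is a sum of \<open>n\<close> quadratic terms weighted by
  \<open>|U_ip U_iq| = 1/n\<close>, hence at most \<open>2 |z|^2\<close>; there are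
  \<open>n^2\<close> entries.\<close>

lemma defect_map_quadratic_bound:
  fixes U z :: "complex ^ 'n ^ 'n"
  assumes U: "biunitary U"
    and unimod: "\<And>i j. cmod (1 + z $ i $ j) = 1"
    and orth: "\<And>p q. p \<noteq> q \<Longrightarrow>
      (\<Sum>i\<in>UNIV. cnj (1 + z $ i $ p) * (1 + z $ i $ q) * (cnj (U $ i $ p) * U $ i $ q)) = 0"
  shows "norm (defect_map U z) \<le> 2 * (real CARD('n))\<^sup>2 * (norm z)\<^sup>2"
proof -
  let ?n = "real CARD('n)"
  have cnj_z: "cnj (z $ i $ j) = - z $ i $ j - z $ i $ j * cnj (z $ i $ j)" for i j
  proof -
    have "(1 + z $ i $ j) * cnj (1 + z $ i $ j) = 1"
      by (rule mult_cnj_eq_1) (rule unimod)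
    then show ?thesis by (simp add: algebra_simps eq_diff_eq add_eq_0_iff)
  qed
  have entry: "cmod (defect_map U z $ p $ q) \<le> 2 * (norm z)\<^sup>2" for p q
  proof (cases "p = q")
    case True
    then show ?thesis by (simp add: defect_map_def)
  next
    case False
    \<comment> \<open>Substituting \<open>cnj_z\<close> for the linear occurrence of
      \<open>cnj z_ip\<close> leaves a remainder that is a product of two small factors.\<close>
    have expand: "cnj (1 + z $ i $ p) * (1 + z $ i $ q) =
        1 - (z $ i $ p - z $ i $ q) - cnj (z $ i $ p) * (z $ i $ p - z $ i $ q)" for i
      using cnj_z[of i p] by (simp add: algebra_simps)
    have "0 = (\<Sum>i\<in>UNIV. cnj (U $ i $ p) * U $ i $ q) - defect_map U z $ p $ q
        - (\<Sum>i\<in>UNIV. cnj (z $ i $ p) * (z $ i $ p - z $ i $ q) * (cnj (U $ i $ p) * U $ i $ q))"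
      using orth[OF False] unfolding expand
      by (simp add: defect_map_def left_diff_distrib sum_subtractf)
    then have "defect_map U z $ p $ q =
        - (\<Sum>i\<in>UNIV. cnj (z $ i $ p) * (z $ i $ p - z $ i $ q) * (cnj (U $ i $ p) * U $ i $ q))"
      using unitary_mat_columns[of U p q] U False
      by (simp add: biunitary_def equation_minus_iff[of "defect_map U z $ p $ q"])
    then have "cmod (defect_map U z $ p $ q) \<le>
        (\<Sum>i\<in>UNIV. cmod (cnj (z $ i $ p) * (z $ i $ p - z $ i $ q) * (cnj (U $ i $ p) * U $ i $ q)))"
      by (simp add: norm_sum del: complex_mod_cnj)
    also have "\<dots> \<le> (\<Sum>i\<in>(UNIV::'n set). norm z * (norm z + norm z) * (1 / ?n))"
    proof (rule sum_mono)
      fix i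
      have UU: "cmod (U $ i $ p) * cmod (U $ i $ q) = 1 / ?n"
        using U by (simp add: biunitary_def)
      have "cmod (z $ i $ p - z $ i $ q) \<le> norm z + norm z"
        by (intro order_trans[OF norm_triangle_ineq4] add_mono cmod_nth_le_norm)
      then show "cmod (cnj (z $ i $ p) * (z $ i $ p - z $ i $ q) * (cnj (U $ i $ p) * U $ i $ q))
          \<le> norm z * (norm z + norm z) * (1 / ?n)"
        unfolding norm_mult complex_mod_cnj UU
        by (intro mult_mono cmod_nth_le_norm) auto
    qed
    also have "\<dots> = 2 * (norm z)\<^sup>2"
      by (simp add: power2_eq_square)
    finally show ?thesis .
  qed
  have "norm (defect_map U z) \<le> (\<Sum>p\<in>UNIV. \<Sum>q\<in>UNIV. cmod (defect_map U z $ p $ q))"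
    by (rule norm_le_sum_cmod)
  also have "\<dots> \<le> (\<Sum>p\<in>(UNIV::'n set). \<Sum>q\<in>(UNIV::'n set). 2 * (norm z)\<^sup>2)"
    by (intro sum_mono entry)
  finally show ?thesis
    by (simp add: power2_eq_square mult_ac)
qed

text \<open>With \<open>E = diag(e)\<close>, conjugation \<open>A \<mapsto> E^* A E\<close> fixes
  diagonal matrices. The row phases \<open>d\<close> commute with diagonal matrices, so they cancel
  in \<open>U^* A U\<close>.\<close>

lemma biunitary_equiv_of_phases:
  fixes U V :: "complex ^ 'n ^ 'n"
  assumes d: "\<And>i. cmod (d i) = 1" and e: "\<And>j. cmod (e j) = 1"
    and UV: "\<And>i j. U $ i $ j = d i * V $ i $ j * e j"
  shows "biunitary_equiv V U"
proof -
  have dd: "d i * cnj (d i) = 1" and ee: "e j * cnj (e j) = 1" for i j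
    using d e by (simp_all add: mult_cnj_eq_1)
  define \<phi> :: "complex ^ 'n ^ 'n \<Rightarrow> complex ^ 'n ^ 'n"
    where "\<phi> A = (\<chi> i j. cnj (e i) * A $ i $ j * e j)" for A
  define \<psi> :: "complex ^ 'n ^ 'n \<Rightarrow> complex ^ 'n ^ 'n"
    where "\<psi> A = (\<chi> i j. e i * A $ i $ j * cnj (e j))" for A
  have e1: "e j * (cnj (e j) * x) = x" for j x
    using ee[of j] by (simp add: mult_ac flip: mult.assoc)
  have e3: "e j * (y * (cnj (e j) * x)) = y * x" for j x y
    by (simp only: mult.left_commute[of y] e1)
  have d3: "d j * (y * (cnj (d j) * x)) = y * x" for j x y
    using dd[of j] by (simp add: mult.left_commute[of y] flip: mult.assoc)
  have inv: "\<psi> (\<phi> A) = A" "\<phi> (\<psi> A) = A" for A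
  proof -
    have "\<psi> (\<phi> A) $ i $ j = (e i * cnj (e i)) * A $ i $ j * (e j * cnj (e j))"
      "\<phi> (\<psi> A) $ i $ j = (e i * cnj (e i)) * A $ i $ j * (e j * cnj (e j))" for i j
      by (simp_all add: \<phi>_def \<psi>_def mult_ac)
    then show "\<psi> (\<phi> A) = A" "\<phi> (\<psi> A) = A"
      by (simp_all add: vec_eq_iff ee)
  qed
  have "bij \<phi>"
    by (rule o_bij[of \<psi>]) (auto simp: inv fun_eq_iff)
  moreover have "Vector_Spaces.linear cscale cscale \<phi>"
    by (intro Vector_Spaces.linear_iff[THEN iffD2] conjI cmat.vector_space_axioms allI)
      (simp_all add: \<phi>_def vec_eq_iff algebra_simps)
  moreover have "\<phi> (A ** B) = \<phi> A ** \<phi> B" for A B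
    by (simp add: \<phi>_def vec_eq_iff matrix_matrix_mult_def sum_distrib_left sum_distrib_right
        mult_ac e3)
  moreover have "\<phi> (adjoint_mat A) = adjoint_mat (\<phi> A)" for A
    by (simp add: \<phi>_def vec_eq_iff mult_ac)
  ultimately have "star_automorphism \<phi>"
    by (simp add: star_automorphism_def)
  moreover have "normalized_trace (\<phi> A) = normalized_trace A" for A
    by (simp add: normalized_trace_def trace_def \<phi>_def mult_ac e1)
  moreover have "\<phi> ` diag_alg = diag_alg"
  proof -
    have "\<phi> A = A" if "A \<in> diag_alg" for A
    proof -
      have "\<phi> A $ i $ j = A $ i $ j" for i j
        using that by (cases "i = j") (simp_all add: \<phi>_def diag_alg_def mult_ac e1)
      then show ?thesis by (simp add: vec_eq_iff)
    qed
    then show ?thesis by simp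
  qed
  moreover have "\<phi> ` conj_diag_alg V = conj_diag_alg U"
  proof -
    have "\<phi> (adjoint_mat V ** A ** V) = adjoint_mat U ** A ** U" if "A \<in> diag_alg" for A
      by (simp add: \<phi>_def vec_eq_iff conj_diag_nth[OF that] UV sum_distrib_left sum_distrib_right
          mult_ac d3)
    then show ?thesis
      by (auto simp: conj_diag_alg_def image_image)
  qed
  ultimately show ?thesis
    unfolding biunitary_equiv_def by blast
qed

section \<open>From injectivity to isolation\<close>

theorem proposition5p1:
  fixes U :: "complex ^ 'n ^ 'n"
  assumes "biunitary U"
    and "int (cmat.dim (commutator_space diag_alg (conj_diag_alg U)))
           = (int CARD('n))\<^sup>2 - 2 * int CARD('n) + 1"
  shows "\<exists>\<epsilon>>0. \<forall>V :: complex ^ 'n ^ 'n.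
           biunitary V \<and> op_norm (V - U) < \<epsilon> \<longrightarrow> biunitary_equiv V U"
proof -
  fix o1 :: 'n
  let ?n = "real CARD('n)"
  have n: "?n > 0" by simp
  have U: "unitary_mat U" and Uabs: "\<And>i j. cmod (U $ i $ j) = 1 / sqrt ?n"
    using assms(1) by (auto simp: biunitary_def)
  have "\<forall>x\<in>normalized_at o1. defect_map U x = 0 \<longrightarrow> x = 0"
    using defect_map_injective[OF U assms(2)] by blast
  \<comment> \<open>An injective linear map on a finite-dimensional subspace is bounded
    below.\<close>
  then obtain c where c: "c > 0"
    and below: "\<And>z. z \<in> normalized_at o1 \<Longrightarrow> c * norm z \<le> norm (defect_map U z)"
    using injective_imp_isometric[OF closed_subspace[OF subspace_normalized_at[of o1]]
        subspace_normalized_at[of o1], of "defect_map U"]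
      linear_defect_map[of U]
    by (auto simp: linear_conv_bounded_linear mult.commute)
  \<comment> \<open>Chosen so that \<open>4 n^2 sqrt n * \<epsilon> = c / (2 n^2)\<close>, the size
    of \<open>z\<close> below which the quadratic bound beats the linear one.\<close>
  define \<epsilon> where "\<epsilon> = c / (8 * ?n ^ 4 * sqrt ?n)"
  have "biunitary_equiv V U" if V: "biunitary V" and near: "op_norm (V - U) < \<epsilon>" for V
  proof -
    define r where "r i j = V $ i $ j / U $ i $ j" for i j
    have Vabs: "cmod (V $ i $ j) = 1 / sqrt ?n" for i j
      using V by (simp add: biunitary_def)
    have U0: "U $ i $ j \<noteq> 0" for i j
      using Uabs[of i j] n by force
    have r1: "cmod (r i j) = 1" for i j
      by (simp add: r_def norm_divide Uabs Vabs)
    have r0: "r i j \<noteq> 0" for i j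
      using r1[of i j] by force
    have Vr: "V $ i $ j = U $ i $ j * r i j" for i j
      using U0 by (simp add: r_def)
    \<comment> \<open>The factor \<open>sqrt n\<close> is \<open>1 / |U_ij|\<close>.\<close>
    define \<delta> where "\<delta> = sqrt ?n * op_norm (V - U)"
    have r_near: "cmod (r i j - 1) \<le> \<delta>" for i j
    proof -
      have "r i j - 1 = (V - U) $ i $ j / U $ i $ j"
        using U0[of i j] by (simp add: r_def field_simps)
      then have "cmod (r i j - 1) = sqrt ?n * cmod ((V - U) $ i $ j)"
        by (simp add: norm_divide Uabs)
      then show ?thesis
        unfolding \<delta>_def using cmod_nth_le_op_norm[of "V - U" i j] by (simp add: mult_left_mono)
    qed
    \<comment> \<open>The ratio \<open>V/U\<close> after multiplying rows and columns by phases that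
      make it 1 in row and column \<open>o1\<close>.\<close>
    define w where "w i j = r i j * r o1 o1 / (r i o1 * r o1 j)" for i j
    define z :: "complex ^ 'n ^ 'n" where "z = (\<chi> i j. w i j - 1)"
    have zn: "z \<in> normalized_at o1"
      using r0 by (simp add: normalized_at_def z_def w_def)
    have quad: "norm (defect_map U z) \<le> 2 * ?n\<^sup>2 * (norm z)\<^sup>2"
    proof (rule defect_map_quadratic_bound[OF assms(1)])
      show "cmod (1 + z $ i $ j) = 1" for i j
        by (simp add: z_def w_def norm_mult norm_divide r1)
      fix p q :: 'n assume "p \<noteq> q"
      have "cnj (r o1 o1) * r o1 o1 = 1" "\<And>i. cnj (r i o1) * r i o1 = 1"
        using r1 by (simp_all add: mult_cnj_eq_1 mult.commute[of "cnj _"])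
      \<comment> \<open>The row phases cancel and the column phases do not depend on
        \<open>i\<close>, so orthogonality of the columns of \<open>V\<close> carries over.\<close>
      then have "cnj (w i p) * w i q * (cnj (U $ i $ p) * U $ i $ q) =
          cnj (V $ i $ p) * V $ i $ q / (cnj (r o1 p) * r o1 q)" for i
      proof -
        have "cnj (w i p) * w i q * (cnj (U $ i $ p) * U $ i $ q) =
          (cnj (V $ i $ p) * V $ i $ q) * (cnj (r o1 o1) * r o1 o1) /
          ((cnj (r o1 p) * r o1 q) * (cnj (r i o1) * r i o1))"
          by (simp add: w_def Vr mult_ac)
        then show ?thesis
          by (simp add: \<open>cnj (r o1 o1) * r o1 o1 = 1\<close> \<open>\<And>i. cnj (r i o1) * r i o1 = 1\<close>)
      qed
      then show "(\<Sum>i\<in>UNIV. cnj (1 + z $ i $ p) * (1 + z $ i $ q) * (cnj (U $ i $ p) * U $ i $ q)) = 0"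
        using unitary_mat_columns[of V p q] V \<open>p \<noteq> q\<close>
        by (simp add: z_def biunitary_def flip: sum_divide_distrib)
    qed
    have z_entry: "cmod (z $ i $ j) \<le> 4 * \<delta>" for i j
    proof -
      have "z $ i $ j = (r i j * r o1 o1 - r i o1 * r o1 j) / (r i o1 * r o1 j)"
        using r0 by (simp add: z_def w_def field_simps)
      then have "cmod (z $ i $ j) = cmod (r i j * r o1 o1 - r i o1 * r o1 j)"
        by (simp add: norm_divide norm_mult r1)
      \<comment> \<open>Four differences of the form \<open>r - 1\<close>, each at most
        \<open>\<delta>\<close> and multiplied by at most a unimodular factor, account for
        \<open>4 * \<delta>\<close>.\<close>
      also have "r i j * r o1 o1 - r i o1 * r o1 j =
          ((r i j - 1) * r o1 o1 + (r o1 o1 - 1)) - ((r i o1 - 1) * r o1 j + (r o1 j - 1))"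
        by (simp add: algebra_simps)
      also have "cmod \<dots> \<le> cmod ((r i j - 1) * r o1 o1 + (r o1 o1 - 1))
          + cmod ((r i o1 - 1) * r o1 j + (r o1 j - 1))"
        by (rule norm_triangle_ineq4)
      also have "\<dots> \<le> (\<delta> + \<delta>) + (\<delta> + \<delta>)"
        by (intro add_mono order_trans[OF norm_triangle_ineq]) (simp_all add: norm_mult r1 r_near)
      finally show ?thesis by simp
    qed
    have "norm z \<le> (\<Sum>i\<in>UNIV. \<Sum>j\<in>UNIV. cmod (z $ i $ j))"
      by (rule norm_le_sum_cmod)
    also have "\<dots> \<le> (\<Sum>i\<in>(UNIV::'n set). \<Sum>j\<in>(UNIV::'n set). 4 * \<delta>)"
      by (intro sum_mono z_entry)
    also have "\<dots> = 4 * ?n\<^sup>2 * sqrt ?n * op_norm (V - U)"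
      by (simp add: power2_eq_square \<delta>_def)
    also have "\<dots> < 4 * ?n\<^sup>2 * sqrt ?n * \<epsilon>"
      using near by (intro mult_strict_left_mono) auto
    also have "\<dots> = c / (2 * ?n\<^sup>2)"
      by (simp add: \<epsilon>_def power2_eq_square power4_eq_xxxx)
    finally have small: "2 * ?n\<^sup>2 * norm z < c"
      by (simp add: field_simps)
    have "z = 0"
    proof (rule ccontr)
      assume "z \<noteq> 0"
      \<comment> \<open>This contradicts \<open>c |z| \<le> |L z| \<le> 2 n^2 |z|^2\<close>, where
        \<open>L\<close> is \<open>defect_map U\<close>.\<close>
      then have "2 * ?n\<^sup>2 * norm z * norm z < c * norm z"
        using small by (intro mult_strict_right_mono) auto
      with below[OF zn] quad show False
        by (simp add: power2_eq_square mult_ac)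
    qed
    then have "w i j = 1" for i j
      by (simp add: z_def vec_eq_iff)
    \<comment> \<open>The ratio matrix \<open>r\<close> thus has rank one, so \<open>V\<close>
      arises from \<open>U\<close> by row and column phases.\<close>
    then have "r i j * r o1 o1 = r i o1 * r o1 j" for i j
      using r0 by (simp add: w_def)
    then have "U $ i $ j = (r o1 o1 / r i o1) * V $ i $ j * (1 / r o1 j)" for i j
      using r0 by (simp add: Vr field_simps)
    then show ?thesis
      by (intro biunitary_equiv_of_phases[of "\<lambda>i. r o1 o1 / r i o1" "\<lambda>j. 1 / r o1 j"])
        (simp_all add: norm_divide r1)
  qed
  moreover have "\<epsilon> > 0"
    using c by (simp add: \<epsilon>_def)
  ultimately show ?thesis by blast
qed

end
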